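(* Let $p$ be a prime, $p>3$, and let $q = p^h$ with $h \in \mathbb{N}$. For any $\varepsilon > 0$, there exists a sequence of non-zero polynomials in $\mathbb{F}_q[t]$ which is a Sidon basis of order $3 + \varepsilon$.
   Context: $\mathbb{F}_q$ is the finite field with $q$ elements. A sequence of non-zero polynomials $\omega$ in $\mathbb{F}_q[t]$ is regarded as a set of polynomials. It is a Sidon sequence if all the sums $a + a'$ with $a, a' \in \omega$ are distinct, up to the order of the summands: if $a+a'=b+b'$ with $a,a',b,b'\in\omega$ then $\{a,a'\}=\{b,b'\}$. It is an asymptotic basis of order $g+\varepsilon$ if every $n \in \mathbb{F}_q[t]$ with $\deg n$ sufficiently large can be written as $n = a_1 + \dots + a_{g+1}$ with $a_1, \dots, a_{g+1} \in \omega$ and $\min_{1 \le i \le g+1} \deg a_i \le \varepsilon \deg n$. It is a Sidon basis of order $g+\varepsilon$ if it is both a Sidon sequence and an asymptotic basis of order $g+\varepsilon$. *)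

theory Defs
  imports Complex_Main "HOL-Library.Cardinality" "HOL-Computational_Algebra.Polynomial"
begin

definition sidon_seq :: "'a::field poly set \<Rightarrow> bool" where
  "sidon_seq \<omega> \<longleftrightarrow>
     (\<forall>a\<in>\<omega>. \<forall>a'\<in>\<omega>. \<forall>b\<in>\<omega>. \<forall>b'\<in>\<omega>. a + a' = b + b' \<longrightarrow> {a, a'} = {b, b'})"

(* The summands need not be distinct.  The library convention degree 0 = 0 does not matter:
   the definition is applied to sets not containing 0, and N can be taken positive. *)
definition asymptotic_basis :: "'a::field poly set \<Rightarrow> nat \<Rightarrow> real \<Rightarrow> bool" where
  "asymptotic_basis \<omega> g \<epsilon> \<longleftrightarrow>
     (\<exists>N. \<forall>n. degree n \<ge> N \<longrightarrow>
        (\<exists>a :: nat \<Rightarrow> 'a poly.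
           (\<forall>i\<in>{1..g+1}. a i \<in> \<omega>) \<and>
           n = (\<Sum>i=1..g+1. a i) \<and>
           real (Min ((\<lambda>i. degree (a i)) ` {1..g+1})) \<le> \<epsilon> * real (degree n)))"

definition sidon_basis :: "'a::field poly set \<Rightarrow> nat \<Rightarrow> real \<Rightarrow> bool" where
  "sidon_basis \<omega> g \<epsilon> \<longleftrightarrow> sidon_seq \<omega> \<and> asymptotic_basis \<omega> g \<epsilon>"

end

theory Submission
  imports Defs "HOL-Number_Theory.Residues" "HOL-Library.Countable_Set"
begin

text \<open>
  The definition of an asymptotic basis bounds the degree of one summand only: the others may have
  degree far above \<open>deg n\<close> and cancel. This freedom makes a greedy construction possible, as in the
  construction of unique representation bases of the integers. Given a finite Sidon set \<open>A\<close> and a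
  polynomial \<open>m\<close> outside \<open>A + A\<close>, adjoin \<open>t\<^sup>D\<close> and \<open>m - t\<^sup>D\<close> with \<open>D\<close> above all degrees involved.
  The coefficient of \<open>t\<^sup>D\<close> in a sum of two elements then reveals which of the two new elements occur
  in it, up to the case of both or neither, which \<open>m \<notin> A + A\<close> settles. So the set stays Sidon, and it
  now represents \<open>m\<close> (\<open>sidon_extension\<close>).

  Going through the countably many polynomials \<open>m\<close> gives a Sidon set \<open>\<omega>\<close> with
  \<open>\<omega> + \<omega> = \<bbbF>\<^sub>q[t]\<close> (\<open>sidon_basis_order_two\<close>). Fix any \<open>c \<in> \<omega>\<close>; writing \<open>n - 2c = x + y\<close>
  yields \<open>n = c + c + x + y\<close>, and the constant \<open>deg c\<close> is at most \<open>\<epsilon> deg n\<close> once \<open>deg n\<close> is large.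
\<close>

text \<open>
  At the exponent \<open>D\<close>, elements of \<open>A\<close> have coefficient \<open>0\<close>, while \<open>x = t\<^sup>D\<close> and \<open>y = m - t\<^sup>D\<close> have
  \<open>1\<close> and \<open>-1\<close>. The sums \<open>x + x\<close>, \<open>x + a\<close>, \<open>x + y\<close> or \<open>a + a'\<close>, \<open>y + a\<close>, \<open>y + y\<close> thus have
  coefficients \<open>2, 1, 0, -1, -2\<close>, which are distinct exactly when neither \<open>2\<close> nor \<open>3\<close> vanishes. The
  only remaining collision would be \<open>x + y = a + a'\<close>, that is, \<open>m \<in> A + A\<close>, and in that case nothing
  has to be adjoined.
\<close>

lemma sidon_extension:
  fixes A :: "'a::field poly set" and m :: "'a poly"
  assumes two: "(2::'a) \<noteq> 0" and three: "(3::'a) \<noteq> 0"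
    and fin: "finite A" and zero: "0 \<notin> A" and sidon: "sidon_seq A"
  shows "\<exists>B. A \<subseteq> B \<and> finite B \<and> 0 \<notin> B \<and> sidon_seq B \<and> (\<exists>x\<in>B. \<exists>y\<in>B. m = x + y)"
proof (cases "\<exists>x\<in>A. \<exists>y\<in>A. m = x + y")
  case True
  with fin zero sidon show ?thesis by blast
next
  case m_notin: False
  define D where "D = Suc (Max (degree ` insert m A))"
  have deg: "degree z < D" if "z \<in> insert m A" for z
    unfolding D_def using fin that by (intro le_imp_less_Suc Max_ge) auto
  define x where "x = Polynomial.monom (1::'a) D"
  define y where "y = m - x"
  have A0: "Polynomial.coeff z D = 0" if "z \<in> A" for z
    using deg that by (intro coeff_eq_0) auto
  have x1: "Polynomial.coeff x D = 1" by (simp add: x_def)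
  have y1: "Polynomial.coeff y D = -1"
    using deg[of m] by (simp add: y_def x1 coeff_eq_0)
  have xy: "x + y = m" "y + x = m" by (simp_all add: y_def)
  have four: "(4::'a) \<noteq> 0"
    using two by (metis mult_eq_0_iff numeral_Bit0 mult_2)
  \<comment> \<open>\<open>P\<close> and \<open>N\<close> collect the coefficients that reveal the presence of \<open>x\<close> and of \<open>y\<close> respectively.\<close>
  define P N :: "'a set" where "P = {1, 2}" and "N = {-1, -2}"
  have disjoint: "0 \<notin> P" "0 \<notin> N" "P \<inter> N = {}"
    using two three four unfolding P_def N_def
    by (auto simp: eq_neg_iff_add_eq_0 neg_eq_iff_add_eq_0)
  define B where "B = A \<union> {x, y}"
  have cases: "z \<in> A \<and> Polynomial.coeff z D = 0 \<or> z = x \<or> z = y" if "z \<in> B" for z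
    using that A0 unfolding B_def by auto
  \<comment> \<open>A pair containing a new element \<open>z\<close> is \<open>{z, s - z}\<close>, where \<open>s\<close> is the sum of the pair; so the
    pair is determined by \<open>s\<close> once \<open>s\<close> reveals a new element of it.\<close>
  have pair: "Polynomial.coeff s D \<in> P \<and> {a, a'} = {x, s - x} \<or>
              Polynomial.coeff s D \<in> N \<and> {a, a'} = {y, s - y} \<or>
              Polynomial.coeff s D = 0 \<and> s = m \<and> {a, a'} = {x, y} \<or>
              Polynomial.coeff s D = 0 \<and> a \<in> A \<and> a' \<in> A"
    if "a \<in> B" "a' \<in> B" and s: "a + a' = s" for a a' s
  proof -
    have "Polynomial.coeff s D = Polynomial.coeff a D + Polynomial.coeff a' D"
      and "s - a = a'" and "s - a' = a"
      using s by auto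
    then show ?thesis
      using cases[OF that(1)] cases[OF that(2)] s
      by (elim disjE conjE) (simp_all add: x1 y1 xy P_def N_def insert_commute)
  qed
  have "sidon_seq B"
    unfolding sidon_seq_def
  proof (intro ballI impI)
    fix a a' b b'
    assume mem: "a \<in> B" "a' \<in> B" "b \<in> B" "b' \<in> B" and eq: "a + a' = b + b'"
    define s where "s = b + b'"
    have sums: "a + a' = s" "b + b' = s" using eq by (simp_all add: s_def)
    have old_pairs: "{a, a'} = {b, b'}" if "a \<in> A" "a' \<in> A" "b \<in> A" "b' \<in> A"
      using sidon that eq unfolding sidon_seq_def by blast
    have new: "s \<noteq> m" if "u \<in> A" "u' \<in> A" "u + u' = s" for u u'
      using m_notin that by metis
    from pair[OF mem(1,2) sums(1)] pair[OF mem(3,4) sums(2)] disjoint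
    consider (xs) "{a, a'} = {x, s - x}" "{b, b'} = {x, s - x}"
      | (ys) "{a, a'} = {y, s - y}" "{b, b'} = {y, s - y}"
      | (xy) "{a, a'} = {x, y}" "{b, b'} = {x, y}"
      | (left) "s = m" "a \<in> A" "a' \<in> A"
      | (right) "s = m" "b \<in> A" "b' \<in> A"
      | (old) "a \<in> A" "a' \<in> A" "b \<in> A" "b' \<in> A"
      by (elim disjE conjE) auto
    then show "{a, a'} = {b, b'}"
    proof cases
      case xs
      then show ?thesis by (simp only:)
    next
      case ys
      then show ?thesis by (simp only:)
    next
      case xy
      then show ?thesis by (simp only:)
    next
      case left
      with new[OF left(2,3) sums(1)] show ?thesis by simp
    next
      case right
      with new[OF right(2,3) sums(2)] show ?thesis by simp
    next
      case old
      then show ?thesis by (rule old_pairs)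
    qed
  qed
  moreover have "x \<noteq> 0" "y \<noteq> 0"
    using x1 y1 by fastforce+
  then have "0 \<notin> B"
    using zero by (simp add: B_def)
  moreover have "A \<subseteq> B" "finite B"
    using fin by (auto simp: B_def)
  moreover have "\<exists>u\<in>B. \<exists>v\<in>B. m = u + v"
    by (intro bexI[of _ x] bexI[of _ y]) (simp_all add: B_def xy)
  ultimately show ?thesis by blast
qed

lemma countable_UNIV_poly: "countable (UNIV :: 'a::{zero,finite} poly set)"
proof -
  have "countable (lists (UNIV :: 'a set))"
    by (intro countable_lists countable_finite) simp
  then have "countable (range (Poly :: 'a list \<Rightarrow> 'a poly))"
    by (intro countable_image) simp
  moreover have "range (Poly :: 'a list \<Rightarrow> 'a poly) = UNIV"
    by (metis Poly_coeffs surjI)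
  ultimately show ?thesis by simp
qed

text \<open>Any two elements of a union of a chain lie in a common member, so the Sidon property passes to
  the limit of the greedy extensions.\<close>

lemma sidon_seq_UN_chain:
  assumes "incseq A" and "\<And>k::nat. sidon_seq (A k)"
  shows "sidon_seq (\<Union>k. A k)"
  unfolding sidon_seq_def
proof (intro ballI impI)
  fix a a' b b'
  assume "a \<in> (\<Union>k. A k)" "a' \<in> (\<Union>k. A k)" "b \<in> (\<Union>k. A k)" "b' \<in> (\<Union>k. A k)"
    and eq: "a + a' = b + b'"
  then obtain i j k l where "a \<in> A i" "a' \<in> A j" "b \<in> A k" "b' \<in> A l" by blast
  moreover define M where "M = Max {i, j, k, l}"
  moreover have "A i \<subseteq> A M" "A j \<subseteq> A M" "A k \<subseteq> A M" "A l \<subseteq> A M"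
    using assms(1) by (simp_all add: incseq_def M_def)
  ultimately have "a \<in> A M" "a' \<in> A M" "b \<in> A M" "b' \<in> A M" by blast+
  then show "{a, a'} = {b, b'}"
    using assms(2)[of M] eq unfolding sidon_seq_def by blast
qed

lemma sidon_basis_order_two:
  assumes two: "(2::'a::{field,finite}) \<noteq> 0" and three: "(3::'a) \<noteq> 0"
  shows "\<exists>\<omega> :: 'a poly set. 0 \<notin> \<omega> \<and> sidon_seq \<omega> \<and> (\<forall>m. \<exists>x\<in>\<omega>. \<exists>y\<in>\<omega>. m = x + y)"
proof -
  define f where "f = from_nat_into (UNIV :: 'a poly set)"
  have surj_f: "surj f"
    unfolding f_def by (intro range_from_nat_into countable_UNIV_poly) simp
  have "\<exists>A :: nat \<Rightarrow> 'a poly set. \<forall>k. (finite (A k) \<and> 0 \<notin> A k \<and> sidon_seq (A k)) \<and>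
          (A k \<subseteq> A (Suc k) \<and> (\<exists>x\<in>A (Suc k). \<exists>y\<in>A (Suc k). f k = x + y))"
  proof (rule dependent_nat_choice)
    show "\<exists>A :: 'a poly set. finite A \<and> 0 \<notin> A \<and> sidon_seq A"
      by (intro exI[of _ "{}"]) (simp add: sidon_seq_def)
  next
    fix A :: "'a poly set" and k
    assume "finite A \<and> 0 \<notin> A \<and> sidon_seq A"
    then show "\<exists>B. (finite B \<and> 0 \<notin> B \<and> sidon_seq B) \<and>
                 (A \<subseteq> B \<and> (\<exists>x\<in>B. \<exists>y\<in>B. f k = x + y))"
      using sidon_extension[OF two three, of A "f k"] by blast
  qed
  then obtain A :: "nat \<Rightarrow> 'a poly set" where
    zero: "\<And>k. 0 \<notin> A k" and sidon: "\<And>k. sidon_seq (A k)" and step: "\<And>k. A k \<subseteq> A (Suc k)"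
    and repr: "\<And>k. \<exists>x\<in>A (Suc k). \<exists>y\<in>A (Suc k). f k = x + y"
    by blast
  have "sidon_seq (\<Union>k. A k)"
    using step sidon by (intro sidon_seq_UN_chain incseq_SucI)
  moreover have "\<exists>x\<in>(\<Union>k. A k). \<exists>y\<in>(\<Union>k. A k). m = x + y" for m
  proof -
    obtain k where "m = f k" using surj_f by (metis surjD)
    then show ?thesis using repr[of k] by blast
  qed
  ultimately show ?thesis
    using zero by (intro exI[of _ "\<Union>k. A k"]) blast
qed

text \<open>The characteristic divides \<open>p ^ h\<close> and is not \<open>1\<close>, hence is a multiple of \<open>p\<close>.\<close>

lemma dvd_if_of_nat_eq_0_CARD_prime_power:
  assumes "prime (p::nat)" and "CARD('a::{field,finite}) = p ^ h" and "of_nat k = (0::'a)"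
  shows "p dvd k"
proof -
  have "CHAR('a) dvd p ^ h"
    using CHAR_dvd_CARD[where 'a = 'a] assms(2) by simp
  then obtain j where j: "CHAR('a) = p ^ j"
    using assms(1) by (auto simp: divides_primepow_nat)
  have "CHAR('a) \<noteq> 1" using of_nat_CHAR[where 'a = 'a] by auto
  with j have "p dvd CHAR('a)" by (cases j) auto
  also have "CHAR('a) dvd k" using assms(3) by (simp add: of_nat_eq_0_iff_char_dvd)
  finally show ?thesis .
qed

theorem theorem1p5:
  fixes p h :: nat and \<epsilon> :: real
  assumes "prime p" and "p > 3" and "h \<ge> 1"
    and "CARD('a::{field,finite}) = p ^ h"
    and "\<epsilon> > 0"
  shows "\<exists>\<omega> :: 'a poly set. 0 \<notin> \<omega> \<and> sidon_basis \<omega> 3 \<epsilon>"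
proof -
  have "of_nat k \<noteq> (0::'a)" if "0 < k" "k \<le> 3" for k
    using dvd_if_of_nat_eq_0_CARD_prime_power[OF assms(1,4), of k] dvd_imp_le[of p k] that assms(2)
    by auto
  from this[of 2] this[of 3] have "(2::'a) \<noteq> 0" "(3::'a) \<noteq> 0" by simp_all
  from sidon_basis_order_two[OF this] obtain \<omega> :: "'a poly set"
    where zero: "0 \<notin> \<omega>" and sidon: "sidon_seq \<omega>"
      and repr: "\<And>m. \<exists>x\<in>\<omega>. \<exists>y\<in>\<omega>. m = x + y" by blast
  obtain c where c: "c \<in> \<omega>" using repr[of 0] by blast
  have "asymptotic_basis \<omega> 3 \<epsilon>"
    unfolding asymptotic_basis_def
  proof (intro exI[of _ "nat \<lceil>real (degree c) / \<epsilon>\<rceil>"] allI impI)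
    fix n :: "'a poly"
    assume "nat \<lceil>real (degree c) / \<epsilon>\<rceil> \<le> degree n"
    then have "real (degree c) / \<epsilon> \<le> real (degree n)" by linarith
    then have deg_c: "real (degree c) \<le> \<epsilon> * real (degree n)"
      using \<open>\<epsilon> > 0\<close> by (simp add: field_simps)
    obtain x y where xy: "x \<in> \<omega>" "y \<in> \<omega>" "n - (c + c) = x + y"
      using repr[of "n - (c + c)"] by blast
    define a where "a i = (if i = 3 then x else if i = 4 then y else c)" for i :: nat
    have idx: "{1..3+1} = {1, 2, 3, 4::nat}" by auto
    show "\<exists>a :: nat \<Rightarrow> 'a poly. (\<forall>i\<in>{1..3+1}. a i \<in> \<omega>) \<and> n = (\<Sum>i=1..3+1. a i) \<and>
        real (Min ((\<lambda>i. degree (a i)) ` {1..3+1})) \<le> \<epsilon> * real (degree n)"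
    proof (intro exI[of _ a] conjI)
      show "\<forall>i\<in>{1..3+1}. a i \<in> \<omega>"
        using c xy by (simp add: a_def)
      show "n = (\<Sum>i=1..3+1. a i)"
        unfolding idx using xy(3) by (simp add: a_def algebra_simps)
      have "Min ((\<lambda>i. degree (a i)) ` {1..3+1}) \<le> degree (a 1)"
        by (intro Min_le) auto
      then show "real (Min ((\<lambda>i. degree (a i)) ` {1..3+1})) \<le> \<epsilon> * real (degree n)"
        using deg_c by (simp add: a_def)
    qed
  qed
  with zero sidon show ?thesis unfolding sidon_basis_def by blast
qed

end
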